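(* Let $A=\{\mathbf a_1,\ldots,\mathbf a_m\}\subset\mathbb Z^n$ be a vector configuration such that $\mathbb NA$ is pointed, and let $I_A\subset K[x_1,\ldots,x_m]$ be its toric ideal. Let $\mathcal M_A$ be the monomial ideal generated by all monomials $\mathbf x^{\mathbf u}$ for which there exists a nonzero binomial $\mathbf x^{\mathbf u}-\mathbf x^{\mathbf v}\in I_A$, and let $T_A$ be the unique minimal monomial generating set of $\mathcal M_A$. Then the indispensable monomials of $I_A$ are precisely the elements of $T_A$.
   Context: $K$ is a field. $\mathbb NA=\{l_1\mathbf a_1+\cdots+l_m\mathbf a_m : l_i\in\mathbb N\}$ with $0\in\mathbb N$; $\mathbb NA$ is pointed if zero is its only invertible element. The $A$-degree of $\mathbf x^{\mathbf u}=x_1^{u_1}\cdots x_m^{u_m}$ is $\deg_A(\mathbf x^{\mathbf u})=u_1\mathbf a_1+\cdots+u_m\mathbf a_m$. The toric ideal $I_A$ is the ideal generated by all binomials $\mathbf x^{\mathbf u}-\mathbf x^{\mathbf v}$ with $\deg_A(\mathbf x^{\mathbf u})=\deg_A(\mathbf x^{\mathbf v})$. A monomial $\mathbf x^{\mathbf u}$ is indispensable (for $I_A$) if every system of binomial generators of $I_A$ contains a binomial $B$ such that $\mathbf x^{\mathbf u}$ is a monomial of $B$. *)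

theory Defs
  imports "HOL-Analysis.Analysis" "HOL-Library.Poly_Mapping"
begin

(* The polynomial ring K[x_i : i in 'm] is the monoid algebra over exponent vectors. *)
type_synonym ('m, 'k) mpolynomial = "('m \<Rightarrow>\<^sub>0 nat) \<Rightarrow>\<^sub>0 'k"

definition monomial :: "('m \<Rightarrow>\<^sub>0 nat) \<Rightarrow> ('m, 'k::field) mpolynomial" where
  "monomial u = Poly_Mapping.single u 1"

(* A commutative ring as a module over itself: its submodules are the ideals,
   so ideal.span S is the ideal generated by S. *)
interpretation ideal: module "(*) :: 'r::comm_ring_1 \<Rightarrow> 'r \<Rightarrow> 'r"
  by standard (simp_all add: algebra_simps)

definition affine_semigroup :: "('m::finite \<Rightarrow> int ^ 'n) \<Rightarrow> (int ^ 'n) set" where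
  "affine_semigroup a = {\<Sum>i\<in>UNIV. int (l i) *s a i | l :: 'm \<Rightarrow> nat. True}"

definition pointed :: "('v::comm_monoid_add) set \<Rightarrow> bool" where
  "pointed M \<longleftrightarrow> (\<forall>x\<in>M. (\<exists>y\<in>M. x + y = 0) \<longrightarrow> x = 0)"

definition A_degree :: "('m::finite \<Rightarrow> int ^ 'n) \<Rightarrow> ('m \<Rightarrow>\<^sub>0 nat) \<Rightarrow> int ^ 'n" where
  "A_degree a u = (\<Sum>i\<in>UNIV. int (Poly_Mapping.lookup u i) *s a i)"

definition toric_ideal :: "('m::finite \<Rightarrow> int ^ 'n) \<Rightarrow> ('m, 'k::field) mpolynomial set" where
  "toric_ideal a = ideal.span {monomial u - monomial v | u v. A_degree a u = A_degree a v}"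

(* S need not be finite.  The zero binomial (u = v) may belong to S; having no monomials,
   it does not affect indispensability. *)
definition binomial_generators ::
    "('m, 'k::field) mpolynomial set \<Rightarrow> ('m, 'k) mpolynomial set \<Rightarrow> bool" where
  "binomial_generators I S \<longleftrightarrow> S \<subseteq> {monomial u - monomial v | u v. True} \<and> ideal.span S = I"

definition indispensable_monomials ::
    "('m, 'k::field) mpolynomial set \<Rightarrow> ('m, 'k) mpolynomial set" where
  "indispensable_monomials I =
     {monomial u | u. \<forall>S. binomial_generators I S \<longrightarrow> (\<exists>B\<in>S. u \<in> Poly_Mapping.keys B)}"

definition M_ideal :: "('m::finite \<Rightarrow> int ^ 'n) \<Rightarrow> ('m, 'k::field) mpolynomial set" where
  "M_ideal a = ideal.span
     {monomial u | u. \<exists>v. monomial u - monomial v \<noteq> (0 :: ('m, 'k) mpolynomial) \<and>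
                       monomial u - monomial v \<in> (toric_ideal a :: ('m, 'k) mpolynomial set)}"

definition minimal_monomial_generators ::
    "('m, 'k::field) mpolynomial set \<Rightarrow> ('m, 'k) mpolynomial set \<Rightarrow> bool" where
  "minimal_monomial_generators I T \<longleftrightarrow>
     T \<subseteq> range monomial \<and> ideal.span T = I \<and> (\<forall>T'. T' \<subset> T \<longrightarrow> ideal.span T' \<noteq> I)"

lemma monomial_in_monomial_ideal_iff:
  "(monomial u :: ('m, 'k::field) mpolynomial) \<in> ideal.span (monomial ` U)
     \<longleftrightarrow> (\<exists>w\<in>U. \<exists>c. u = w + c)"
proof
  let ?D = "{w + c | w c. w \<in> U}"
  let ?P = "{p :: ('m, 'k) mpolynomial. Poly_Mapping.keys p \<subseteq> ?D}"
  assume u: "(monomial u :: ('m, 'k) mpolynomial) \<in> ideal.span (monomial ` U)"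
  have "ideal.subspace ?P"
  proof (rule ideal.subspaceI)
    show "0 \<in> ?P" by simp
  next
    fix x y assume "x \<in> ?P" "y \<in> ?P"
    then show "x + y \<in> ?P" using Poly_Mapping.keys_add[of x y] by blast
  next
    fix c x :: "('m, 'k) mpolynomial" assume "x \<in> ?P"
    moreover have "d + z \<in> ?D" if "z \<in> ?D" for d z
    proof -
      from that obtain w e where "z = w + e" "w \<in> U" by blast
      then have "d + z = w + (e + d)" "w \<in> U" by (simp_all add: ac_simps)
      then show ?thesis by blast
    qed
    ultimately have "{d + z | d z. d \<in> Poly_Mapping.keys c \<and> z \<in> Poly_Mapping.keys x} \<subseteq> ?D"
      by blast
    then show "c * x \<in> ?P" using subset_trans[OF keys_mult[of c x]] by simp
  qed
  moreover have "monomial ` U \<subseteq> ?P"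
    by (force simp: monomial_def intro: exI[of _ 0])
  ultimately have "ideal.span (monomial ` U) \<subseteq> ?P" by (rule ideal.span_minimal[rotated])
  with u have "Poly_Mapping.keys (monomial u :: ('m, 'k) mpolynomial) \<subseteq> ?D" by blast
  then show "\<exists>w\<in>U. \<exists>c. u = w + c" by (auto simp: monomial_def)
next
  assume "\<exists>w\<in>U. \<exists>c. u = w + c"
  then obtain w c where w: "w \<in> U" "u = w + c" by blast
  have "(monomial u :: ('m, 'k) mpolynomial) = monomial c * monomial w"
    by (simp add: monomial_def mult_single w add.commute)
  with w show "(monomial u :: ('m, 'k) mpolynomial) \<in> ideal.span (monomial ` U)"
    by (auto intro: ideal.span_scale ideal.span_base)
qed

lemma exponent_order_antisym:
  fixes u v :: "'m \<Rightarrow>\<^sub>0 nat"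
  assumes "u = v + c" and "v = u + d"
  shows "u = v"
proof (rule poly_mapping_eqI)
  fix i
  have "Poly_Mapping.lookup u i = Poly_Mapping.lookup v i + Poly_Mapping.lookup c i"
    by (simp add: assms(1) lookup_add)
  moreover have "Poly_Mapping.lookup v i = Poly_Mapping.lookup u i + Poly_Mapping.lookup d i"
    by (subst assms(2)) (simp add: lookup_add)
  ultimately show "Poly_Mapping.lookup u i = Poly_Mapping.lookup v i" by simp
qed

lemma minimal_exponent_exists:
  fixes U :: "('m::finite \<Rightarrow>\<^sub>0 nat) set"
  assumes "u \<in> U"
  shows "\<exists>w\<in>U. (\<exists>c. u = w + c) \<and> (\<forall>w'\<in>U. (\<exists>c. w = w' + c) \<longrightarrow> w' = w)"
proof -
  let ?f = "\<lambda>w :: 'm \<Rightarrow>\<^sub>0 nat. \<Sum>i\<in>UNIV. Poly_Mapping.lookup w i"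
  let ?Q = "\<lambda>w. w \<in> U \<and> (\<exists>c. u = w + c)"
  have "?Q u" using assms by (auto intro: exI[of _ 0])
  then obtain w where w: "?Q w" and least: "\<And>y. ?Q y \<Longrightarrow> ?f w \<le> ?f y"
    using ex_has_least_nat[of ?Q u ?f] by blast
  have "w' = w" if w': "w' \<in> U" "w = w' + c" for w' c
  proof -
    have "?Q w'" using w w' by (auto simp: add.assoc)
    then have "?f w \<le> ?f w'" by (rule least)
    moreover have "?f w = ?f w' + ?f c" by (simp add: w' lookup_add sum.distrib)
    ultimately have "?f c = 0" by simp
    then have "c = 0" by (intro poly_mapping_eqI) simp
    with w' show ?thesis by simp
  qed
  with w show ?thesis by blast
qed

lemma ex1_minimal_monomial_generators:
  fixes U :: "('m::finite \<Rightarrow>\<^sub>0 nat) set"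
  shows "\<exists>!T. minimal_monomial_generators
           (ideal.span (monomial ` U) :: ('m, 'k::field) mpolynomial set) T"
proof -
  let ?m = "monomial :: ('m \<Rightarrow>\<^sub>0 nat) \<Rightarrow> ('m, 'k) mpolynomial"
  let ?I = "ideal.span (?m ` U)"
  define V where "V = {w \<in> U. \<forall>w'\<in>U. (\<exists>c. w = w' + c) \<longrightarrow> w' = w}"
  have genV: "ideal.span (?m ` V) = ?I"
  proof
    show "ideal.span (?m ` V) \<subseteq> ?I" by (rule ideal.span_mono) (auto simp: V_def)
    have "?m u \<in> ideal.span (?m ` V)" if "u \<in> U" for u
      using minimal_exponent_exists[OF that] unfolding monomial_in_monomial_ideal_iff V_def by blast
    then show "?I \<subseteq> ideal.span (?m ` V)"
      by (intro ideal.span_minimal) (auto simp: ideal.subspace_span)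
  qed
  have V_in: "v \<in> W" if W: "ideal.span (?m ` W) = ?I" and v: "v \<in> V" for W v
  proof -
    have "?m v \<in> ideal.span (?m ` W)" unfolding W genV[symmetric] using v by (simp add: ideal.span_base)
    then obtain w c where w: "w \<in> W" "v = w + c" unfolding monomial_in_monomial_ideal_iff by blast
    have "?m w \<in> ?I" unfolding W[symmetric] using w(1) by (simp add: ideal.span_base)
    then obtain u d where u: "u \<in> U" "w = u + d" unfolding monomial_in_monomial_ideal_iff by blast
    have "v = u + (d + c)" using w u by (simp add: add.assoc)
    moreover have "\<forall>w'\<in>U. (\<exists>c. v = w' + c) \<longrightarrow> w' = v" using v by (simp add: V_def)
    ultimately have "u = v" using u(1) by blast
    then have "v = w" using exponent_order_antisym[OF w(2)] u(2) by simp
    then show ?thesis using w by simp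
  qed
  have V_least: "?m ` V \<subseteq> T" if "T \<subseteq> range ?m" "ideal.span T = ?I" for T
  proof -
    from that(1) obtain W where "T = ?m ` W" by (auto simp: subset_image_iff)
    with V_in[of W] that(2) show ?thesis by auto
  qed
  show ?thesis
  proof (rule ex1I)
    show "minimal_monomial_generators ?I (?m ` V)"
      unfolding minimal_monomial_generators_def
    proof (intro conjI allI impI)
      show "?m ` V \<subseteq> range ?m" by blast
      show "ideal.span (?m ` V) = ?I" by (rule genV)
      fix T' assume "T' \<subset> ?m ` V"
      then show "ideal.span T' \<noteq> ?I" using V_least[of T'] by blast
    qed
  next
    fix T assume T: "minimal_monomial_generators ?I T"
    then have "?m ` V \<subseteq> T" using V_least unfolding minimal_monomial_generators_def by blast
    with T genV show "T = ?m ` V" unfolding minimal_monomial_generators_def by blast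
  qed
qed

lemma ex1_minimal_generators_M_ideal:
  "\<exists>!T. minimal_monomial_generators (M_ideal a :: ('m::finite, 'k::field) mpolynomial set) T"
  unfolding M_ideal_def image_Collect[symmetric] by (rule ex1_minimal_monomial_generators)

(* Well defined by ex1_minimal_generators_M_ideal. *)
definition T_generators :: "('m::finite \<Rightarrow> int ^ 'n) \<Rightarrow> ('m, 'k::field) mpolynomial set" where
  "T_generators a = (THE T. minimal_monomial_generators (M_ideal a) T)"

end

theory Submission
  imports Defs
begin

text \<open>
  Let \<open>U\<close> be the set of exponents of monomials occurring in nonzero binomials of an ideal \<open>I\<close>
  generated by binomials. Every exponent occurring in an element of \<open>ideal.span S\<close> is a translate
  of one occurring in \<open>S\<close>, so a minimal element of \<open>U\<close> must occur in each generating set.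
  Conversely, let \<open>u = w + c\<close> with \<open>w \<in> U\<close> and \<open>c \<noteq> 0\<close>, and let \<open>x\<^sup>w - x\<^sup>z \<in> I\<close> with \<open>z \<noteq> w\<close>.
  One can arrange \<open>z \<noteq> u\<close>: if \<open>z = w + c\<close>, replace it by \<open>w + c + c\<close>. Then
  \<open>x\<^sup>u - x\<^sup>v = x\<^sup>c (x\<^sup>w - x\<^sup>z) + (x\<^sup>c x\<^sup>z - x\<^sup>v)\<close> rewrites each binomial of \<open>I\<close> containing \<open>x\<^sup>u\<close>
  in terms of binomials of \<open>I\<close> that avoid it, so the latter generate \<open>I\<close>.
\<close>

lemma monomial_add: "monomial (u + v) = monomial u * monomial v"
  by (simp add: monomial_def mult_single)

lemma monomial_eq_iff [simp]:
  "(monomial u :: ('m, 'k::field) mpolynomial) = monomial v \<longleftrightarrow> u = v"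
proof
  assume "(monomial u :: ('m, 'k) mpolynomial) = monomial v"
  then have "Poly_Mapping.keys (monomial u :: ('m, 'k) mpolynomial)
      = Poly_Mapping.keys (monomial v :: ('m, 'k) mpolynomial)"
    by simp
  then show "u = v" by (simp add: monomial_def)
qed simp

lemma keys_binomial:
  "Poly_Mapping.keys (monomial u - monomial v :: ('m, 'k::field) mpolynomial)
     = (if u = v then {} else {u, v})"
  by (auto simp: monomial_def in_keys_iff lookup_minus lookup_single when_def split: if_splits)

text \<open>Exponents of a product are sums of exponents of the factors, and adding polynomials
  creates no new exponents; cancellation can only remove some.\<close>

lemma keys_span:
  fixes p :: "('m, 'k::field) mpolynomial"
  assumes "p \<in> ideal.span S" and "u \<in> Poly_Mapping.keys p"
  shows "\<exists>B\<in>S. \<exists>w\<in>Poly_Mapping.keys B. \<exists>c. u = w + c"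
  using assms
proof (induction arbitrary: u rule: ideal.span_induct_alt)
  case base
  then show ?case by simp
next
  case (step d B y)
  then consider "u \<in> Poly_Mapping.keys (d * B)" | "u \<in> Poly_Mapping.keys y"
    using Poly_Mapping.keys_add[of "d * B" y] by blast
  then show ?case
  proof cases
    case 1
    then obtain c w where "u = c + w" "w \<in> Poly_Mapping.keys B"
      using keys_mult[of d B] by blast
    with step.hyps(1) show ?thesis by (metis add.commute)
  next
    case 2
    then show ?thesis by (rule step.IH)
  qed
qed

text \<open>For \<open>I = toric_ideal a\<close> the monomials with these exponents generate
  \<open>M_ideal a\<close>; \<open>u \<noteq> v\<close> encodes that the binomial is
  nonzero.\<close>

definition binomial_exponents :: "('m, 'k::field) mpolynomial set \<Rightarrow> ('m \<Rightarrow>\<^sub>0 nat) set" where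
  "binomial_exponents I = {u. \<exists>v. u \<noteq> v \<and> monomial u - monomial v \<in> I}"

text \<open>\<open>binomial_exponents\<close> looks only at the first term of a binomial; closure of
  \<open>I\<close> under negation covers the second.\<close>

lemma binomial_keys_exponents:
  fixes I :: "('m, 'k::field) mpolynomial set"
  assumes I: "ideal.subspace I" and B: "monomial p - monomial q \<in> I"
    and u: "u \<in> Poly_Mapping.keys (monomial p - monomial q :: ('m, 'k) mpolynomial)"
  shows "u \<in> binomial_exponents I"
proof -
  have "monomial q - monomial p \<in> I"
    using ideal.subspace_neg[OF I B] by simp
  with u B show ?thesis
    unfolding binomial_exponents_def keys_binomial by (auto split: if_splits)
qed

lemma minimal_monomial_generators_minimal:
  fixes I :: "('m, 'k::field) mpolynomial set"
  assumes T: "minimal_monomial_generators I T" and u: "monomial u \<in> T"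
    and v: "monomial v \<in> I" and uv: "u = v + c"
  shows "v = u"
proof -
  let ?m = "monomial :: ('m \<Rightarrow>\<^sub>0 nat) \<Rightarrow> ('m, 'k) mpolynomial"
  obtain W where W: "T = ?m ` W" and span: "ideal.span T = I"
    using T unfolding minimal_monomial_generators_def subset_image_iff by blast
  obtain w d where w: "w \<in> W" "v = w + d"
    using v span monomial_in_monomial_ideal_iff W by metis
  \<comment> \<open>Otherwise \<open>monomial u\<close> is a multiple of another generator, as
    \<open>u = w + (d + c)\<close>, and could be dropped from \<open>T\<close>.\<close>
  have "w = u"
  proof (rule ccontr)
    assume "w \<noteq> u"
    then have "?m w \<in> T - {?m u}" using w W by auto
    then have "?m (d + c) * ?m w \<in> ideal.span (T - {?m u})"
      by (intro ideal.span_scale ideal.span_base)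
    moreover have "?m u = ?m (d + c) * ?m w"
      by (simp add: uv w(2) monomial_add[symmetric] add_ac)
    ultimately have "?m u \<in> ideal.span (T - {?m u})" by simp
    then have "T \<subseteq> ideal.span (T - {?m u})"
      using ideal.span_base[of _ "T - {?m u}"] by blast
    then have "ideal.span T \<subseteq> ideal.span (T - {?m u})"
      by (rule ideal.span_minimal) (rule ideal.subspace_span)
    moreover have "ideal.span (T - {?m u}) \<subseteq> ideal.span T"
      by (rule ideal.span_mono) blast
    ultimately have "ideal.span (T - {?m u}) = I" using span by blast
    moreover have "T - {?m u} \<subset> T" using u by blast
    ultimately show False using T unfolding minimal_monomial_generators_def by blast
  qed
  with w uv show ?thesis by (metis exponent_order_antisym)
qed

text \<open>By \<open>keys_span\<close>, some exponent \<open>w\<close> of a generator divides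
  \<open>u\<close>. It lies in \<open>binomial_exponents I\<close> too, so minimality gives
  \<open>w = u\<close>.\<close>

lemma minimal_exponent_in_generators:
  fixes I :: "('m, 'k::field) mpolynomial set"
  assumes S: "binomial_generators I S" and u: "u \<in> binomial_exponents I"
    and min: "\<And>w c. w \<in> binomial_exponents I \<Longrightarrow> u = w + c \<Longrightarrow> w = u"
  shows "\<exists>B\<in>S. u \<in> Poly_Mapping.keys B"
proof -
  have span: "ideal.span S = I" and bin: "S \<subseteq> {monomial u - monomial v | u v. True}"
    using S unfolding binomial_generators_def by auto
  have I: "ideal.subspace I" using span ideal.subspace_span by blast
  obtain v where "u \<noteq> v" "(monomial u - monomial v :: ('m, 'k) mpolynomial) \<in> ideal.span S"
    using u span unfolding binomial_exponents_def by blast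
  then obtain B w c where B: "B \<in> S" "w \<in> Poly_Mapping.keys B" "u = w + c"
    using keys_span[of "monomial u - monomial v" S u] by (auto simp: keys_binomial)
  obtain p q where "B = monomial p - monomial q" using B bin by blast
  moreover have "B \<in> I" using B span ideal.span_base by blast
  ultimately have "w \<in> binomial_exponents I"
    using binomial_keys_exponents[OF I] B(2) by blast
  then have "w = u" using B(3) by (rule min)
  with B(1,2) show ?thesis by blast
qed

text \<open>\<open>S\<close> is the largest candidate: all binomials of \<open>I\<close> that avoid
  \<open>w + c\<close>. It suffices that its span contains \<open>F\<close>.\<close>

lemma binomial_generators_avoiding:
  fixes I :: "('m, 'k::field) mpolynomial set"
  assumes F: "binomial_generators I F" and w: "w \<in> binomial_exponents I" and c: "c \<noteq> 0"
  defines "S \<equiv> {B \<in> {monomial p - monomial q | p q. True} \<inter> I. w + c \<notin> Poly_Mapping.keys B}"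
  shows "binomial_generators I S"
proof -
  let ?m = "monomial :: ('m \<Rightarrow>\<^sub>0 nat) \<Rightarrow> ('m, 'k) mpolynomial"
  let ?u = "w + c"
  have F_span: "ideal.span F = I" and F_bin: "F \<subseteq> {?m p - ?m q | p q. True}"
    using F unfolding binomial_generators_def by auto
  have I: "ideal.subspace I" using F_span ideal.subspace_span by blast
  have S_I: "p \<noteq> ?u \<Longrightarrow> q \<noteq> ?u \<Longrightarrow> ?m p - ?m q \<in> I \<Longrightarrow> ?m p - ?m q \<in> ideal.span S" for p q
    by (rule ideal.span_base) (auto simp: S_def keys_binomial)
  \<comment> \<open>\<open>z \<noteq> ?u\<close> puts the binomial of \<open>w\<close> and
    \<open>z\<close> into \<open>S\<close>; \<open>z \<noteq> w\<close> keeps \<open>c + z\<close>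
    away from \<open>?u\<close>.\<close>
  have "\<exists>z. z \<noteq> w \<and> z \<noteq> ?u \<and> ?m w - ?m z \<in> I"
  proof -
    obtain z where z: "w \<noteq> z" "?m w - ?m z \<in> I"
      using w unfolding binomial_exponents_def by blast
    show ?thesis
    proof (cases "z = ?u")
      case True
      have "?m c * (?m w - ?m ?u) \<in> I"
        using z True I ideal.subspace_scale by blast
      \<comment> \<open>The sum telescopes: the two copies of \<open>?m ?u\<close> cancel, leaving
        \<open>w\<close> and \<open>w + c + c\<close>.\<close>
      then have "(?m w - ?m ?u) + ?m c * (?m w - ?m ?u) \<in> I"
        using z True I ideal.subspace_add by blast
      moreover have "(?m w - ?m ?u) + ?m c * (?m w - ?m ?u) = ?m w - ?m (w + c + c)"
        by (simp add: right_diff_distrib monomial_add[symmetric] add_ac)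
      moreover have "w + c + c \<noteq> w"
      proof
        assume "w + c + c = w"
        then have "c + c = 0" by (simp add: add.assoc)
        then have "Poly_Mapping.lookup (c + c) i = 0" for i by simp
        then have "c = 0" by (intro poly_mapping_eqI) (simp add: lookup_add)
        with c show False by simp
      qed
      moreover have "w + c + c \<noteq> ?u" using c by simp
      ultimately have "?m w - ?m (w + c + c) \<in> I" "w + c + c \<noteq> w" "w + c + c \<noteq> ?u"
        by (simp_all only: not_False_eq_True)
      then show ?thesis by blast
    qed (use z in auto)
  qed
  then obtain z where z: "z \<noteq> w" "z \<noteq> ?u" "?m w - ?m z \<in> I" by blast
  have u: "?m ?u - ?m v \<in> ideal.span S" if v: "?m ?u - ?m v \<in> I" for v
  proof (cases "v = ?u")
    case False
    have eq: "?m (c + z) - ?m v = (?m ?u - ?m v) - ?m c * (?m w - ?m z)"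
      by (simp add: right_diff_distrib monomial_add[symmetric] add_ac)
    have "?m c * (?m w - ?m z) \<in> I" using z I ideal.subspace_scale by blast
    then have "?m (c + z) - ?m v \<in> I"
      unfolding eq using v I ideal.subspace_diff by blast
    moreover have "c + z \<noteq> ?u" using z by (simp add: add.commute)
    ultimately have "?m (c + z) - ?m v \<in> ideal.span S" using False S_I by blast
    moreover have "?m c * (?m w - ?m z) \<in> ideal.span S"
      using z c by (intro ideal.span_scale S_I) auto
    ultimately have "(?m (c + z) - ?m v) + ?m c * (?m w - ?m z) \<in> ideal.span S"
      by (rule ideal.span_add)
    then show ?thesis unfolding eq by simp
  qed (simp add: ideal.span_zero)
  have "F \<subseteq> ideal.span S"
  proof
    fix B assume "B \<in> F"
    then obtain p q where B: "B = ?m p - ?m q" "?m p - ?m q \<in> I"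
      using F_bin F_span ideal.span_base by blast
    consider "p = ?u" | "q = ?u" | "p \<noteq> ?u" "q \<noteq> ?u" by blast
    then show "B \<in> ideal.span S"
    proof cases
      case 2
      \<comment> \<open>Fact \<open>u\<close> treats \<open>?u\<close> as first term only, so the
        binomial is negated before and after using it.\<close>
      have "?m q - ?m p \<in> I" using ideal.subspace_neg[OF I B(2)] by simp
      then have "?m q - ?m p \<in> ideal.span S" using u 2 by blast
      then have "- (?m q - ?m p) \<in> ideal.span S" by (rule ideal.span_neg)
      then show ?thesis by (simp add: B)
    qed (use B u S_I in auto)
  qed
  then have "I \<subseteq> ideal.span S"
    using F_span ideal.span_minimal ideal.subspace_span by blast
  moreover have "ideal.span S \<subseteq> I"
    by (rule ideal.span_minimal[OF _ I]) (auto simp: S_def)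
  ultimately show ?thesis unfolding binomial_generators_def by (auto simp: S_def)
qed

lemma indispensable_monomials_eq_minimal_generators:
  fixes I :: "('m, 'k::field) mpolynomial set"
  assumes F: "binomial_generators I F"
    and T: "minimal_monomial_generators (ideal.span (monomial ` binomial_exponents I)) T"
  shows "indispensable_monomials I = T"
proof -
  let ?m = "monomial :: ('m \<Rightarrow>\<^sub>0 nat) \<Rightarrow> ('m, 'k) mpolynomial"
  let ?U = "binomial_exponents I"
  let ?M = "ideal.span (?m ` ?U)"
  have T_range: "T \<subseteq> range ?m" and T_span: "ideal.span T = ?M"
    using T unfolding minimal_monomial_generators_def by auto
  have F_span: "ideal.span F = I" and F_bin: "F \<subseteq> {?m p - ?m q | p q. True}"
    using F unfolding binomial_generators_def by auto
  have I: "ideal.subspace I" using F_span ideal.subspace_span by blast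
  have U_M: "?m v \<in> ?M" if "v \<in> ?U" for v
    using that by (simp add: ideal.span_base)
  \<comment> \<open>Some \<open>v\<close> in \<open>?U\<close> divides \<open>u\<close>; as
    \<open>?m v\<close> lies in \<open>?M\<close>, minimality of \<open>T\<close> forces
    \<open>v = u\<close>.\<close>
  have T_U: "u \<in> ?U" if u: "?m u \<in> T" for u
  proof -
    have "?m u \<in> ?M" using u T_span ideal.span_base by blast
    then obtain v c where v: "v \<in> ?U" "u = v + c"
      unfolding monomial_in_monomial_ideal_iff by blast
    from minimal_monomial_generators_minimal[OF T u U_M[OF v(1)] v(2)] v(1)
    show ?thesis by simp
  qed
  show ?thesis
  proof
    show "T \<subseteq> indispensable_monomials I"
    proof
      fix t assume t: "t \<in> T"
      then obtain u where u: "t = ?m u" using T_range by blast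
      have "\<exists>B\<in>S. u \<in> Poly_Mapping.keys B" if "binomial_generators I S" for S
      proof (rule minimal_exponent_in_generators[OF that])
        show "u \<in> ?U" using t u T_U by simp
        show "w = u" if "w \<in> ?U" "u = w + c" for w c
          using minimal_monomial_generators_minimal[OF T _ U_M[OF that(1)] that(2)] t u by simp
      qed
      then show "t \<in> indispensable_monomials I"
        unfolding indispensable_monomials_def u by blast
    qed
  next
    show "indispensable_monomials I \<subseteq> T"
    proof
      fix t assume "t \<in> indispensable_monomials I"
      then obtain u where u: "t = ?m u"
        and ind: "\<And>S. binomial_generators I S \<Longrightarrow> \<exists>B\<in>S. u \<in> Poly_Mapping.keys B"
        unfolding indispensable_monomials_def by blast
      \<comment> \<open>Testing indispensability on \<open>F\<close> itself places \<open>u\<close>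
        in \<open>?U\<close>, hence above some exponent \<open>w\<close> of
        \<open>T\<close>.\<close>
      obtain B where B: "B \<in> F" "u \<in> Poly_Mapping.keys B" using ind[OF F] by blast
      moreover obtain p q where "B = ?m p - ?m q" using B F_bin by blast
      moreover have "B \<in> I" using B F_span ideal.span_base by blast
      ultimately have "u \<in> ?U" using binomial_keys_exponents[OF I] by blast
      then have "?m u \<in> ideal.span T" using U_M T_span by blast
      moreover obtain W where W: "T = ?m ` W" using T_range by (auto simp: subset_image_iff)
      ultimately obtain w c where w: "?m w \<in> T" "u = w + c"
        using monomial_in_monomial_ideal_iff by blast
      \<comment> \<open>If \<open>c\<close> were nonzero, the generating set avoiding
        \<open>w + c\<close> would contradict indispensability of \<open>u\<close>.\<close>
      have "c = 0"
        using ind[OF binomial_generators_avoiding[OF F T_U[OF w(1)]]] w(2) by blast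
      with w u show "t \<in> T" by simp
    qed
  qed
qed

theorem proposition4p1:
  fixes a :: "'m::finite \<Rightarrow> int ^ 'n::finite"
  assumes "pointed (affine_semigroup a)"
  shows "indispensable_monomials (toric_ideal a :: ('m, 'k::field) mpolynomial set)
           = T_generators a"
proof (rule indispensable_monomials_eq_minimal_generators)
  let ?I = "toric_ideal a :: ('m, 'k) mpolynomial set"
  show "binomial_generators ?I {monomial u - monomial v | u v. A_degree a u = A_degree a v}"
    unfolding binomial_generators_def toric_ideal_def by blast
  \<comment> \<open>The two descriptions agree because a difference of monomials vanishes exactly
    when the exponents coincide.\<close>
  have "(M_ideal a :: ('m, 'k) mpolynomial set) = ideal.span (monomial ` binomial_exponents ?I)"
    unfolding M_ideal_def binomial_exponents_def image_Collect by simp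
  moreover have "minimal_monomial_generators (M_ideal a) (T_generators a :: ('m, 'k) mpolynomial set)"
    unfolding T_generators_def by (rule theI'[OF ex1_minimal_generators_M_ideal])
  ultimately show "minimal_monomial_generators
      (ideal.span (monomial ` binomial_exponents ?I)) (T_generators a :: ('m, 'k) mpolynomial set)"
    by simp
qed

end
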